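(* Let $(X,d)$ be a Hadamard space, let $\alpha>0$, and let $f:X\to\,]-\infty,+\infty]$ be a proper, lower semicontinuous, $\alpha$-weakly convex and quasi-convex function with $\operatorname{Argmin} f\neq\varnothing$. Let $\bar\lambda>0$ and let $(\lambda_n)_{n\ge 0}$ be real numbers with $\bar\lambda\le\lambda_n<\frac{1}{2\alpha}$ for all $n$. Let $x_0\in X$ and define $x_{n+1}=J_{\lambda_n}x_n$ for $n\ge 0$. Put $C=\{x\in X: f(x)\le f(x_n)\text{ for all } n\in\mathbb N\}$. If for some $n>0$ the set $\{x\in X: f(x)\le f(x_n)\}$ is compact, then $(x_n)$ converges strongly (i.e. in the metric $d$) to an element of $C$, which is also a critical point of $f$. Moreover, if $f$ is pseudo-convex, then $(x_n)$ converges strongly to a minimum point of $f$.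
   Context: A Hadamard space is a complete CAT(0) space; it is uniquely geodesic. For $x,y\in X$ and $t\in[0,1]$, $(1-t)x\oplus ty$ denotes the unique point $z$ of the geodesic segment $[x,y]$ with $d(x,z)=t\,d(x,y)$ and $d(y,z)=(1-t)d(x,y)$. For $f:X\to\,]-\infty,+\infty]$: $D(f)=\{x\in X: f(x)<+\infty\}$; $f$ is proper if $D(f)\ne\varnothing$; $f$ is lower semicontinuous if $\liminf_n f(y_n)\ge f(x)$ whenever $y_n\to x$ in $X$. $\operatorname{Argmin} f$ is the set of (global) minimum points of $f$. $f$ is $\alpha$-weakly convex if $f(\lambda x\oplus(1-\lambda)y)\le\lambda f(x)+(1-\lambda)f(y)+\alpha\lambda(1-\lambda)d^2(x,y)$ for all $x,y\in X$, $\lambda\in[0,1]$. $f$ is quasi-convex if $f(\lambda x\oplus(1-\lambda)y)\le\max\{f(x),f(y)\}$ for all $x,y\in X$, $\lambda\in[0,1]$. $f$ is pseudo-convex if, whenever $f(y)>f(x)$, there exist $\beta(x,y)>0$ and $0<\delta(x,y)\le1$ such that $f(y)-f(tx\oplus(1-t)y)\ge t\beta(x,y)$ for all $t\in(0,\delta(x,y))$. Slope and critical points: for $x\in D(f)$, $|\partial f|(x)=\limsup_{y\to x}\frac{\max\{f(x)-f(y),0\}}{d(x,y)}$; a point $x\in D(f)$ with $|\partial f|(x)=0$ is called a critical point of $f$. Resolvent: for $0<\lambda<\frac1{2\alpha}$ and $x\in X$, $J_\lambda x$ denotes the unique minimum point of $y\mapsto f(y)+\frac{1}{2\lambda}d^2(x,y)$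 on $X$. *)

theory Defs
  imports "HOL-Analysis.Analysis"
begin

definition (in metric_space) is_geodesic_segment :: "'a set \<Rightarrow> 'a \<Rightarrow> 'a \<Rightarrow> bool" where
  "is_geodesic_segment S x y \<longleftrightarrow>
     (\<exists>c. c 0 = x \<and> c (dist x y) = y \<and>
          (\<forall>s\<in>{0..dist x y}. \<forall>t\<in>{0..dist x y}. dist (c s) (c t) = \<bar>s - t\<bar>) \<and>
          S = c ` {0..dist x y})"

text \<open>
  The class of complete CAT(0) spaces, the CAT(0) condition being the comparison of geodesic
  triangles with their comparison triangles in the Euclidean plane. Two points on the same side of
  a triangle have the same distance as their comparison points, and two different sides share a
  vertex. So, after relabelling, it suffices to compare a point on a side [p,q] with a point on
  a side [p,r], for all p, q, r.
\<close>

class hadamard_space = complete_space +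
  assumes geodesic: "\<exists>S. is_geodesic_segment S x y"
    and CAT0_comparison:
      "\<lbrakk>is_geodesic_segment S p q; is_geodesic_segment T p r; x \<in> S; y \<in> T;
        dist p' q' = dist p q; dist p' r' = dist p r; dist q' r' = dist q r;
        x' \<in> closed_segment p' q'; dist p' x' = dist p x;
        y' \<in> closed_segment p' r'; dist p' y' = dist p y\<rbrakk>
       \<Longrightarrow> dist x y \<le> dist (x' :: real^2) y'"

definition geodesic_segment :: "'a::hadamard_space \<Rightarrow> 'a \<Rightarrow> 'a set" where
  "geodesic_segment x y = (THE S. is_geodesic_segment S x y)"

text \<open>
  \<open>geodesic_comb x y t\<close> is the point written (1 - t)x \<open>\<oplus>\<close> ty, so that
  tx \<open>\<oplus>\<close> (1 - t)y is \<open>geodesic_comb x y (1 - t)\<close>.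
\<close>

definition geodesic_comb :: "'a::hadamard_space \<Rightarrow> 'a \<Rightarrow> real \<Rightarrow> 'a" where
  "geodesic_comb x y t =
     (THE z. z \<in> geodesic_segment x y \<and> dist x z = t * dist x y \<and> dist y z = (1 - t) * dist x y)"

definition eff_domain :: "('a \<Rightarrow> ereal) \<Rightarrow> 'a set" where
  "eff_domain f = {x. f x < \<infinity>}"

text \<open>Values in ]-\<open>\<infinity>\<close>, +\<open>\<infinity>\<close>] are part of properness here.\<close>

definition proper :: "('a \<Rightarrow> ereal) \<Rightarrow> bool" where
  "proper f \<longleftrightarrow> (\<forall>x. f x \<noteq> -\<infinity>) \<and> eff_domain f \<noteq> {}"

definition lower_semicontinuous :: "('a::topological_space \<Rightarrow> ereal) \<Rightarrow> bool" where
  "lower_semicontinuous f \<longleftrightarrow> (\<forall>x y. y \<longlonglongrightarrow> x \<longrightarrow> liminf (\<lambda>n. f (y n)) \<ge> f x)"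

definition Argmin :: "('a \<Rightarrow> ereal) \<Rightarrow> 'a set" where
  "Argmin f = {x. is_arg_min f (\<lambda>_. True) x}"

definition weakly_convex :: "real \<Rightarrow> ('a::hadamard_space \<Rightarrow> ereal) \<Rightarrow> bool" where
  "weakly_convex \<alpha> f \<longleftrightarrow>
     (\<forall>x y. \<forall>l\<in>{0..1}. f (geodesic_comb x y (1 - l))
        \<le> ereal l * f x + ereal (1 - l) * f y + ereal (\<alpha> * l * (1 - l) * (dist x y)\<^sup>2))"

definition quasi_convex :: "('a::hadamard_space \<Rightarrow> ereal) \<Rightarrow> bool" where
  "quasi_convex f \<longleftrightarrow>
     (\<forall>x y. \<forall>l\<in>{0..1}. f (geodesic_comb x y (1 - l)) \<le> max (f x) (f y))"

text \<open>
  As \<open>\<infinity> - \<infinity> = \<infinity>\<close> in \<^typ>\<open>ereal\<close>, the inequality below amounts to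
  f(tx \<open>\<oplus>\<close> (1 - t)y) + \<open>t\<beta>\<close> \<open>\<le>\<close> f(y). In particular it holds whenever f(y) is infinite.
\<close>

definition pseudo_convex :: "('a::hadamard_space \<Rightarrow> ereal) \<Rightarrow> bool" where
  "pseudo_convex f \<longleftrightarrow>
     (\<forall>x y. f y > f x \<longrightarrow>
        (\<exists>\<beta> \<delta>::real. \<beta> > 0 \<and> 0 < \<delta> \<and> \<delta> \<le> 1 \<and>
           (\<forall>t\<in>{0<..<\<delta>}. f y - f (geodesic_comb x y (1 - t)) \<ge> ereal (t * \<beta>))))"

text \<open>
  The slope is meant for points of \<open>eff_domain f\<close>. The upper limit is one of nonnegative quantities, so
  that it is 0 at an isolated point, whereas \<^const>\<open>Limsup\<close> along the trivial filter
  is \<open>-\<infinity>\<close>. This only matters if the space is a single point.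
\<close>

definition slope :: "('a::metric_space \<Rightarrow> ereal) \<Rightarrow> 'a \<Rightarrow> ereal" where
  "slope f x =
     (if x islimpt UNIV
      then Limsup (at x) (\<lambda>y. max (f x - f y) 0 / ereal (dist x y))
      else 0)"

definition critical_point :: "('a::metric_space \<Rightarrow> ereal) \<Rightarrow> 'a \<Rightarrow> bool" where
  "critical_point f x \<longleftrightarrow> x \<in> eff_domain f \<and> slope f x = 0"

definition resolvent :: "('a::metric_space \<Rightarrow> ereal) \<Rightarrow> real \<Rightarrow> 'a \<Rightarrow> 'a" where
  "resolvent f l x = (THE z. z \<in> Argmin (\<lambda>y. f y + ereal (1 / (2 * l) * (dist x y)\<^sup>2)))"

end

theory Submission
  imports Defs
begin

text \<open>
  Quasi-convexity makes the resolvent sequence Fejer monotone: comparing x(n+1) with the points of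
  the geodesic from x(n+1) to some z with f z \<open>\<le>\<close> f(x(n+1)), the values of f can be
  dropped from the minimality of x(n+1), and the CAT(0) inequality gives d(x(n+1), z) \<open>\<le>\<close> d(x(n), z).
  By compactness of a sublevel set a subsequence converges, by lower semicontinuity its limit p lies
  in C, and by Fejer monotonicity the whole sequence converges to p. Passing to the limit in the
  minimality of x(n+1) gives f p \<open>\<le>\<close> f y + K d(p, y)^2 for all y, with K = 1/(2 \<open>\<lambda>\<close>bar).
  As the error is quadratic, p is critical, and a linear decrease of f along a geodesic
  starting at p, which pseudo-convexity would give if p were no minimizer, is impossible.
\<close>

section \<open>Euclidean comparison triangles\<close>

text \<open>Stewart's theorem for the cevian from \<open>r\<close>. Once squared distances are
  expanded into inner products, it is a polynomial identity.\<close>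

lemma euclidean_stewart:
  fixes p q r :: "'a::real_inner"
  shows "(dist ((1 - t) *\<^sub>R p + t *\<^sub>R q) r)\<^sup>2
    = (1 - t) * (dist p r)\<^sup>2 + t * (dist q r)\<^sup>2 - t * (1 - t) * (dist p q)\<^sup>2"
proof -
  have sq: "(dist a b)\<^sup>2 = a \<bullet> a - 2 * (a \<bullet> b) + b \<bullet> b" for a b :: 'a
    by (simp add: dist_norm power2_norm_eq_inner inner_diff inner_commute)
  show ?thesis
    unfolding sq inner_add_left inner_add_right inner_scaleR_left inner_scaleR_right
      inner_commute[of q p]
    by algebra
qed

lemma dist_affine:
  fixes p q :: "'a::real_normed_vector"
  assumes "0 \<le> t"
  shows "dist p ((1 - t) *\<^sub>R p + t *\<^sub>R q) = t * dist p q"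
proof -
  have "p - ((1 - t) *\<^sub>R p + t *\<^sub>R q) = t *\<^sub>R (p - q)"
    by (simp add: algebra_simps)
  with assms show ?thesis by (simp add: dist_norm)
qed

text \<open>Place \<open>p'\<close> at the origin and \<open>q'\<close> on the first axis. The
  triangle inequalities are what makes the height of the third vertex real.\<close>

lemma ex_comparison_triangle:
  fixes p q r :: "'a::metric_space"
  obtains p' q' r' :: "real^2"
  where "dist p' q' = dist p q" "dist p' r' = dist p r" "dist q' r' = dist q r"
proof -
  define a b c where "a = dist p q" and "b = dist p r" and "c = dist q r"
  have tri: "a \<le> b + c" "b \<le> a + c" "c \<le> a + b" "0 \<le> a" "0 \<le> b" "0 \<le> c"
    unfolding a_def b_def c_def
    by (metis dist_triangle dist_commute zero_le_dist)+
  have "\<exists>p' q' r' :: real^2. dist p' q' = a \<and> dist p' r' = b \<and> dist q' r' = c"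
  proof (cases "a = 0")
    \<comment> \<open>Here \<open>p'\<close> and \<open>q'\<close> coincide, and the triangle
      inequalities force \<open>b = c\<close>.\<close>
    case True
    have "dist (vector [0,0] :: real^2) (vector [b,0]) = b"
      using tri by (simp add: dist_vec_def L2_set_def UNIV_2 dist_real_def)
    with True tri show ?thesis
      by (intro exI[of _ "vector [0,0]"] exI[of _ "vector [b,0]"]) auto
  next
    case False
    \<comment> \<open>The law of cosines gives \<open>u\<close> as the first coordinate of
      \<open>r'\<close>, so \<open>b\<^sup>2 - u\<^sup>2\<close> must be its squared height.\<close>
    define u where "u = (a\<^sup>2 + b\<^sup>2 - c\<^sup>2) / (2 * a)"
    have ua: "2 * a * u = a\<^sup>2 + b\<^sup>2 - c\<^sup>2"
      using False by (simp add: u_def)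
    have "(2 * a)\<^sup>2 * (b\<^sup>2 - u\<^sup>2) = (2 * a * b)\<^sup>2 - (2 * a * u)\<^sup>2"
      by (simp add: algebra_simps power_mult_distrib)
    \<comment> \<open>Heron's factorization: each factor is nonnegative by the triangle
      inequalities.\<close>
    also have "\<dots> = ((a + b)\<^sup>2 - c\<^sup>2) * (c\<^sup>2 - (a - b)\<^sup>2)"
      unfolding ua by (simp add: algebra_simps power2_eq_square)
    also have "\<dots> \<ge> 0"
    proof -
      have "c\<^sup>2 \<le> (a + b)\<^sup>2" using tri by (intro power_mono) auto
      moreover have "(a - b)\<^sup>2 \<le> c\<^sup>2" using tri by (intro abs_le_square_iff[THEN iffD1]) auto
      ultimately show ?thesis by simp
    qed
    finally have "0 \<le> b\<^sup>2 - u\<^sup>2"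
      using False by (simp add: zero_le_mult_iff)
    then have v: "(sqrt (b\<^sup>2 - u\<^sup>2))\<^sup>2 = b\<^sup>2 - u\<^sup>2" by simp
    have "(a - u)\<^sup>2 + (b\<^sup>2 - u\<^sup>2) = c\<^sup>2"
      using ua by (simp add: power2_diff algebra_simps)
    then have "dist (vector [a,0] :: real^2) (vector [u, sqrt (b\<^sup>2 - u\<^sup>2)]) = c"
      "dist (vector [0,0] :: real^2) (vector [u, sqrt (b\<^sup>2 - u\<^sup>2)]) = b"
      "dist (vector [0,0] :: real^2) (vector [a, 0]) = a"
      using tri v by (simp_all add: dist_vec_def L2_set_def UNIV_2 dist_real_def)
    then show ?thesis by blast
  qed
  with that show ?thesis unfolding a_def b_def c_def by blast
qed

section \<open>Unique geodesics and the CAT(0) inequality\<close>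

lemma is_geodesic_segment_endpoint: "is_geodesic_segment S p q \<Longrightarrow> q \<in> S"
  unfolding is_geodesic_segment_def
  by (metis atLeastAtMost_iff imageI order_refl zero_le_dist)

lemma is_geodesic_segment_dist_le:
  assumes "is_geodesic_segment S p q" "z \<in> S"
  shows "dist p z \<le> dist p q"
proof -
  from assms obtain c s where c: "c 0 = p" "s \<in> {0..dist p q}" "z = c s"
    "\<forall>s\<in>{0..dist p q}. \<forall>t\<in>{0..dist p q}. dist (c s) (c t) = \<bar>s - t\<bar>"
    unfolding is_geodesic_segment_def by blast
  have "dist (c 0) (c s) = \<bar>0 - s\<bar>" using c(2,4) by force
  with c show ?thesis by simp
qed

lemma is_geodesic_segment_ex_point:
  assumes "is_geodesic_segment S p q" "t \<in> {0..1}"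
  obtains z where "z \<in> S" "dist p z = t * dist p q" "dist q z = (1 - t) * dist p q"
proof -
  from assms(1) obtain c where c: "c 0 = p" "c (dist p q) = q"
    and d: "\<forall>s\<in>{0..dist p q}. \<forall>t\<in>{0..dist p q}. dist (c s) (c t) = \<bar>s - t\<bar>"
    and S: "S = c ` {0..dist p q}"
    unfolding is_geodesic_segment_def by blast
  have t: "t * dist p q \<in> {0..dist p q}"
    using assms(2) by (auto intro: mult_left_le_one_le)
  have "dist (c 0) (c (t * dist p q)) = \<bar>0 - t * dist p q\<bar>"
    "dist (c (dist p q)) (c (t * dist p q)) = \<bar>dist p q - t * dist p q\<bar>"
    using d t by auto
  with that[of "c (t * dist p q)"] c S t assms(2) show ?thesis
    by (auto simp: algebra_simps)
qed

text \<open>Apply the comparison axiom to the degenerate triangle \<open>p\<close>,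
  \<open>q\<close>, \<open>q\<close>: both points have the same comparison point \<open>z'\<close>,
  hence distance 0.\<close>

lemma geodesic_points_eq:
  fixes p q :: "'a::hadamard_space"
  assumes "is_geodesic_segment S p q" "is_geodesic_segment T p q"
    and "z \<in> S" "w \<in> T" "dist p z = dist p w"
  shows "z = w"
proof -
  obtain p' q' r' :: "real^2" where d: "dist p' q' = dist p q"
    by (rule ex_comparison_triangle[of p q q])
  define t where "t = (if dist p q = 0 then 0 else dist p z / dist p q)"
  define z' where "z' = (1 - t) *\<^sub>R p' + t *\<^sub>R q'"
  have le: "dist p z \<le> dist p q"
    using is_geodesic_segment_dist_le assms(1,3) by blast
  have t: "0 \<le> t" "t \<le> 1" "t * dist p q = dist p z"
    using le by (auto simp: t_def divide_le_eq zero_less_dist_iff)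
  have "dist p' z' = dist p z"
    unfolding z'_def dist_affine[OF t(1)] d by (rule t(3))
  moreover have "z' \<in> closed_segment p' q'"
    using t by (auto simp: z'_def closed_segment_def)
  ultimately have "dist z w \<le> dist z' z'"
    using CAT0_comparison[OF assms(1,2,3,4) d d, of z' z'] assms(5) by simp
  then show ?thesis by simp
qed

text \<open>Used in both directions, this makes geodesic segments unique, so that the description in
  \<open>geodesic_segment\<close> is well defined.\<close>

lemma is_geodesic_segment_subset:
  fixes p q :: "'a::hadamard_space"
  assumes "is_geodesic_segment S p q" "is_geodesic_segment T p q"
  shows "S \<subseteq> T"
proof
  fix z assume z: "z \<in> S"
  define t where "t = (if dist p q = 0 then 0 else dist p z / dist p q)"
  have t: "t \<in> {0..1}" "t * dist p q = dist p z"
    using is_geodesic_segment_dist_le[OF assms(1) z]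
    by (auto simp: t_def divide_le_eq zero_less_dist_iff)
  then obtain w where w: "w \<in> T" "dist p z = dist p w"
    using is_geodesic_segment_ex_point[OF assms(2) t(1)] by metis
  then show "z \<in> T"
    using geodesic_points_eq[OF assms z w] by simp
qed

lemma is_geodesic_segment_geodesic_segment:
  "is_geodesic_segment (geodesic_segment p q) p q"
  unfolding geodesic_segment_def
  by (rule theI', rule ex_ex1I[OF geodesic])
    (intro subset_antisym is_geodesic_segment_subset)

text \<open>The description in \<open>geodesic_comb\<close> denotes: a point of a segment is already
  determined by its distance to \<open>p\<close>.\<close>

lemma geodesic_comb:
  assumes "t \<in> {0..1}"
  shows "geodesic_comb p q t \<in> geodesic_segment p q"
    and "dist p (geodesic_comb p q t) = t * dist p q"
    and "dist q (geodesic_comb p q t) = (1 - t) * dist p q"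
proof -
  note S = is_geodesic_segment_geodesic_segment[of p q]
  have "\<exists>!z. z \<in> geodesic_segment p q \<and> dist p z = t * dist p q \<and> dist q z = (1 - t) * dist p q"
    using is_geodesic_segment_ex_point[OF S assms] geodesic_points_eq[OF S S]
    by (metis (no_types, lifting))
  from theI'[OF this, folded geodesic_comb_def]
  show "geodesic_comb p q t \<in> geodesic_segment p q"
    "dist p (geodesic_comb p q t) = t * dist p q"
    "dist q (geodesic_comb p q t) = (1 - t) * dist p q" by blast+
qed

text \<open>Compare the point on the side from \<open>p\<close> to \<open>q\<close> with the
  endpoint \<open>z\<close> of the side from \<open>p\<close> to \<open>z\<close>, then evaluate the
  planar distance by Stewart's theorem.\<close>

lemma CAT0_inequality:
  assumes t: "t \<in> {0..1}"
  shows "(dist z (geodesic_comb p q t))\<^sup>2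
    \<le> (1 - t) * (dist z p)\<^sup>2 + t * (dist z q)\<^sup>2 - t * (1 - t) * (dist p q)\<^sup>2"
proof -
  obtain p' q' z' :: "real^2" where d: "dist p' q' = dist p q" "dist p' z' = dist p z"
    "dist q' z' = dist q z"
    by (rule ex_comparison_triangle)
  define m' where "m' = (1 - t) *\<^sub>R p' + t *\<^sub>R q'"
  have "dist p' m' = dist p (geodesic_comb p q t)"
    unfolding m'_def geodesic_comb(2)[OF t] using t d by (simp add: dist_affine)
  moreover have "m' \<in> closed_segment p' q'"
    using t by (auto simp: m'_def closed_segment_def)
  ultimately have "dist (geodesic_comb p q t) z \<le> dist m' z'"
    using d geodesic_comb(1)[OF t] is_geodesic_segment_endpoint[OF is_geodesic_segment_geodesic_segment]
      is_geodesic_segment_geodesic_segment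
    by (intro CAT0_comparison[where p = p and q = q and r = z and p' = p' and q' = q' and r' = z'
          and S = "geodesic_segment p q" and T = "geodesic_segment p z"]) auto
  then have "(dist z (geodesic_comb p q t))\<^sup>2 \<le> (dist m' z')\<^sup>2"
    by (simp add: dist_commute power_mono)
  then show ?thesis
    unfolding m'_def euclidean_stewart d by (simp add: dist_commute)
qed

section \<open>Existence and uniqueness of the resolvent\<close>

lemma Argmin_iff: "z \<in> Argmin f \<longleftrightarrow> (\<forall>y. f z \<le> f y)"
  for f :: "'a \<Rightarrow> ereal"
  by (auto simp: Argmin_def is_arg_min_def not_less)

lemma lower_semicontinuous_le_lim:
  assumes "lower_semicontinuous f" "y \<longlonglongrightarrow> l"
    and "eventually (\<lambda>n. f (y n) \<le> r n) sequentially" "r \<longlonglongrightarrow> R"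
  shows "f l \<le> R"
proof -
  have "f l \<le> liminf (\<lambda>n. f (y n))"
    using assms(1,2) by (auto simp: lower_semicontinuous_def)
  also have "\<dots> \<le> liminf r"
    by (rule Liminf_mono) (rule assms(3))
  also have "\<dots> = R"
    by (rule lim_imp_Liminf) (use assms(4) in auto)
  finally show ?thesis .
qed

text \<open>At the midpoint of \<open>u\<close> and \<open>v\<close>, weak convexity loses
  \<open>\<alpha> / 4\<close> times the squared distance, while the CAT(0) inequality gains
  \<open>c / 4\<close> times it. So for \<open>\<alpha> < c\<close> near-minimizers of the
  regularized function are close together.\<close>

lemma weakly_convex_prox_gap:
  fixes f :: "'a::hadamard_space \<Rightarrow> ereal"
  assumes wc: "weakly_convex \<alpha> f" and c: "0 \<le> c" and f: "\<And>y. f y \<noteq> -\<infinity>"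
    and i: "\<And>w. ereal i \<le> f w + ereal (c * (dist x w)\<^sup>2)"
    and u: "f u + ereal (c * (dist x u)\<^sup>2) \<le> ereal s"
    and v: "f v + ereal (c * (dist x v)\<^sup>2) \<le> ereal t"
  shows "(c - \<alpha>) / 4 * (dist u v)\<^sup>2 \<le> (s + t) / 2 - i"
proof -
  \<comment> \<open>The parameter is written \<open>1 - 1/2\<close> to match
    \<open>weakly_convex\<close> with weight \<open>1/2\<close>.\<close>
  define m where "m = geodesic_comb u v (1 - 1/2)"
  obtain fu where fu: "f u = ereal fu"
    using u f[of u] by (cases "f u") auto
  obtain fv where fv: "f v = ereal fv"
    using v f[of v] by (cases "f v") auto
  have "f m \<le> ereal (1/2) * f u + ereal (1 - 1/2) * f v + ereal (\<alpha> * (1/2) * (1 - 1/2) * (dist u v)\<^sup>2)"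
    unfolding m_def by (rule wc[unfolded weakly_convex_def, rule_format]) simp
  then have "f m \<le> ereal (fu / 2 + fv / 2 + \<alpha> / 4 * (dist u v)\<^sup>2)"
    by (simp add: fu fv)
  moreover have "ereal i \<le> f m + ereal (c * (dist x m)\<^sup>2)" by (rule i)
  ultimately have "i \<le> fu / 2 + fv / 2 + \<alpha> / 4 * (dist u v)\<^sup>2 + c * (dist x m)\<^sup>2"
    by (cases "f m") auto
  moreover have "c * (dist x m)\<^sup>2
      \<le> c * ((dist x u)\<^sup>2 / 2 + (dist x v)\<^sup>2 / 2 - (dist u v)\<^sup>2 / 4)"
    using CAT0_inequality[of "1 - 1/2" x u v] c
    by (intro mult_left_mono) (simp_all add: m_def)
  moreover have "fu + c * (dist x u)\<^sup>2 \<le> s" "fv + c * (dist x v)\<^sup>2 \<le> t"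
    using u v by (simp_all add: fu fv)
  ultimately show ?thesis by (simp add: algebra_simps) argo
qed

text \<open>By the gap estimate a minimizing sequence is Cauchy. Completeness and lower
  semicontinuity turn its limit into a minimizer.\<close>

lemma prox_ex1:
  fixes f :: "'a::hadamard_space \<Rightarrow> ereal"
  assumes pr: "proper f" and lsc: "lower_semicontinuous f" and wc: "weakly_convex \<alpha> f"
    and a: "\<And>y. f a \<le> f y" and c: "0 \<le> c" "\<alpha> < c"
  shows "\<exists>!z. z \<in> Argmin (\<lambda>y. f y + ereal (c * (dist x y)\<^sup>2))"
proof -
  let ?g = "\<lambda>y. f y + ereal (c * (dist x y)\<^sup>2)"
  have f: "f y \<noteq> -\<infinity>" for y using pr by (simp add: proper_def)
  have "f a \<noteq> \<infinity>"
    using pr a by (fastforce simp: proper_def eff_domain_def)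
  then obtain m where m: "f a = ereal m" using f[of a] by (cases "f a") auto
  have low: "ereal m \<le> ?g y" for y
    using a[of y] f[of y] c(1) m by (cases "f y") (auto intro: order_trans)
  have "ereal m \<le> (INF y. ?g y)" "(INF y. ?g y) \<le> ?g a"
    using low by (auto intro: INF_greatest INF_lower)
  then obtain i where i: "(INF y. ?g y) = ereal i"
    using m by (cases "INF y. ?g y") auto
  have inf: "ereal i \<le> ?g w" for w
    unfolding i[symmetric] by (rule INF_lower) simp
  note gap = weakly_convex_prox_gap[OF wc c(1) f inf]
  have "\<exists>y. ?g y < ereal (i + 1 / real (Suc n))" for n
  proof -
    have "(INF y. ?g y) < ereal (i + 1 / real (Suc n))" unfolding i by simp
    then show ?thesis by (simp add: INF_less_iff)
  qed
  then obtain y where y: "\<And>n. ?g (y n) < ereal (i + 1 / real (Suc n))" by metis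
  have bound: "(dist (y n) (y k))\<^sup>2 \<le> 2 / (c - \<alpha>) * (1 / real (Suc n) + 1 / real (Suc k))" for n k
  proof -
    have "D \<le> 2 / (c - \<alpha>) * (s + t)"
      if "(c - \<alpha>) / 4 * D \<le> ((i + s) + (i + t)) / 2 - i" for D s t
      using that c(2) by (simp add: field_simps)
    then show ?thesis
      using gap[OF less_imp_le[OF y[of n]] less_imp_le[OF y[of k]]] .
  qed
  have "Cauchy y"
  proof (rule metric_CauchyI)
    fix e :: real assume e: "0 < e"
    then have "0 < e\<^sup>2 * (c - \<alpha>) / 4" using c(2) by simp
    \<comment> \<open>Two such reciprocals add up to less than
      \<open>e\<^sup>2 * (c - \<alpha>) / 2\<close>, which cancels the factor
      \<open>2 / (c - \<alpha>)\<close> of \<open>bound\<close>.\<close>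
    then obtain N where N: "1 / real (Suc N) < e\<^sup>2 * (c - \<alpha>) / 4"
      using reals_Archimedean by (metis inverse_eq_divide)
    have "dist (y n) (y k) < e" if "n \<ge> N" "k \<ge> N" for n k
    proof -
      have "1 / real (Suc n) \<le> 1 / real (Suc N)" "1 / real (Suc k) \<le> 1 / real (Suc N)"
        using that by (auto intro!: divide_left_mono)
      then have "1 / real (Suc n) + 1 / real (Suc k) < e\<^sup>2 * (c - \<alpha>) / 2"
        using N by linarith
      then have "2 / (c - \<alpha>) * (1 / real (Suc n) + 1 / real (Suc k))
          < 2 / (c - \<alpha>) * (e\<^sup>2 * (c - \<alpha>) / 2)"
        using c(2) by (intro mult_strict_left_mono) auto
      also have "\<dots> = e\<^sup>2" using c(2) by simp
      finally show ?thesis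
        using bound[of n k] e by (intro power_less_imp_less_base[of _ 2 e]) auto
    qed
    then show "\<exists>N. \<forall>n\<ge>N. \<forall>k\<ge>N. dist (y n) (y k) < e" by blast
  qed
  then obtain l where l: "y \<longlonglongrightarrow> l"
    using Cauchy_convergent_iff convergent_def by blast
  \<comment> \<open>The continuous quadratic term moves to the right, so that lower semicontinuity
    of \<open>f\<close> alone suffices.\<close>
  have "f (y n) \<le> ereal (i + 1 / real (Suc n) - c * (dist x (y n))\<^sup>2)" for n
    using y[of n] by (cases "f (y n)") auto
  moreover have "(\<lambda>n. ereal (i + 1 / real (Suc n) - c * (dist x (y n))\<^sup>2))
      \<longlonglongrightarrow> ereal (i + 0 - c * (dist x l)\<^sup>2)"
    by (intro tendsto_intros l LIMSEQ_Suc[OF lim_1_over_n])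
  ultimately have "f l \<le> ereal (i + 0 - c * (dist x l)\<^sup>2)"
    by (intro lower_semicontinuous_le_lim[OF lsc l, where r = "\<lambda>n. ereal (i + 1 / real (Suc n) - c * (dist x (y n))\<^sup>2)"] always_eventually)
      blast+
  then have gl: "?g l \<le> ereal i" by (cases "f l") auto
  have "l \<in> Argmin ?g"
    unfolding Argmin_iff using order_trans[OF gl inf] by blast
  \<comment> \<open>Uniqueness is the gap estimate with both upper bounds equal to the infimum
    \<open>i\<close>.\<close>
  moreover have "z = l" if "z \<in> Argmin ?g" for z
  proof -
    have "?g z \<le> ereal i"
      using that gl unfolding Argmin_iff by (blast intro: order_trans)
    from gap[OF this gl] have "(c - \<alpha>) / 4 * (dist z l)\<^sup>2 \<le> 0" by simp
    with c(2) show ?thesis by (simp add: mult_le_0_iff)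
  qed
  ultimately show ?thesis by blast
qed

text \<open>The upper bound on \<open>l\<close> says exactly that \<open>c = 1 / (2 * l)\<close>
  exceeds \<open>\<alpha>\<close>, as \<open>prox_ex1\<close> requires.\<close>

lemma resolvent_le:
  fixes f :: "'a::hadamard_space \<Rightarrow> ereal"
  assumes "proper f" "lower_semicontinuous f" "weakly_convex \<alpha> f" "Argmin f \<noteq> {}"
    and "0 < l" "l < 1 / (2 * \<alpha>)" "0 < \<alpha>"
  shows "f (resolvent f l x) + ereal (1 / (2 * l) * (dist x (resolvent f l x))\<^sup>2)
    \<le> f y + ereal (1 / (2 * l) * (dist x y)\<^sup>2)"
proof -
  have "\<alpha> < 1 / (2 * l)" using assms(5-7) by (simp add: field_simps)
  moreover obtain a where "\<forall>y. f a \<le> f y" using assms(4) Argmin_iff[of _ f] by blast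
  ultimately have "\<exists>!z. z \<in> Argmin (\<lambda>y. f y + ereal (1 / (2 * l) * (dist x y)\<^sup>2))"
    using assms by (intro prox_ex1) auto
  from theI'[OF this, folded resolvent_def] show ?thesis
    by (simp add: Argmin_iff)
qed

section \<open>Fejer monotonicity\<close>

text \<open>On the geodesic from \<open>w\<close> to \<open>z\<close> the point nearest to
  \<open>x\<close> is \<open>w\<close>. As for projections onto convex sets, this yields the
  Pythagorean inequality d(x,w)^2 + d(w,z)^2 \<le> d(x,z)^2.\<close>

lemma quasi_convex_prox_fejer:
  fixes f :: "'a::hadamard_space \<Rightarrow> ereal"
  assumes qc: "quasi_convex f" and c: "0 < c" and fin: "\<bar>f w\<bar> \<noteq> \<infinity>"
    and min: "\<And>y. f w + ereal (c * (dist x w)\<^sup>2) \<le> f y + ereal (c * (dist x y)\<^sup>2)"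
    and z: "f z \<le> f w"
  shows "dist w z \<le> dist x z"
proof -
  have main: "(dist x w)\<^sup>2 \<le> (dist x z)\<^sup>2 - (1 - t) * (dist w z)\<^sup>2" if t: "0 < t" "t \<le> 1" for t
  proof -
    define v where "v = geodesic_comb w z t"
    have "f (geodesic_comb w z (1 - (1 - t))) \<le> max (f w) (f z)"
      using t by (intro qc[unfolded quasi_convex_def, rule_format]) auto
    then have "f v \<le> f w" using z by (simp add: v_def max_absorb1)
    then have "f w + ereal (c * (dist x w)\<^sup>2) \<le> f w + ereal (c * (dist x v)\<^sup>2)"
      using order_trans[OF min[of v]] add_right_mono by blast
    then have "(dist x w)\<^sup>2 \<le> (dist x v)\<^sup>2"
      \<comment> \<open>Cancelling \<open>f w\<close> on both sides is legitimate because it is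
        finite.\<close>
      using fin c by (cases "f w") auto
    also have "\<dots> \<le> (1 - t) * (dist x w)\<^sup>2 + t * (dist x z)\<^sup>2 - t * (1 - t) * (dist w z)\<^sup>2"
      unfolding v_def using t by (intro CAT0_inequality) auto
    finally have "t * (dist x w)\<^sup>2 \<le> t * ((dist x z)\<^sup>2 - (1 - t) * (dist w z)\<^sup>2)"
      by (simp add: algebra_simps)
    then show ?thesis using t by simp
  qed
  \<comment> \<open>The estimate \<open>main\<close> came from a division by \<open>t\<close>, so
    the value at 0 is reached only as a limit.\<close>
  have "(dist x w)\<^sup>2 \<le> (dist x z)\<^sup>2 - (1 - 0) * (dist w z)\<^sup>2"
  proof (rule tendsto_lowerbound)
    show "((\<lambda>t. (dist x z)\<^sup>2 - (1 - t) * (dist w z)\<^sup>2)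
        \<longlongrightarrow> (dist x z)\<^sup>2 - (1 - 0) * (dist w z)\<^sup>2) (at_right 0)"
      by (intro tendsto_intros)
    show "\<forall>\<^sub>F t in at_right 0. (dist x w)\<^sup>2 \<le> (dist x z)\<^sup>2 - (1 - t) * (dist w z)\<^sup>2"
      using main by (auto simp: eventually_at_right_field intro!: exI[of _ 1])
  qed simp
  then have "(dist w z)\<^sup>2 \<le> (dist x z)\<^sup>2"
    using zero_le_power2[of "dist x w"] unfolding diff_zero mult_1 by linarith
  then show ?thesis by (rule power2_le_imp_le) simp
qed

section \<open>Consequences of a quadratic minorant\<close>

text \<open>The difference quotient at \<open>y\<close> is at most
  \<open>\<bar>K\<bar> * dist p y\<close>, which tends to 0.\<close>

lemma critical_point_if_quadratic_minorant:
  fixes f :: "'a::metric_space \<Rightarrow> ereal"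
  assumes fin: "\<bar>f p\<bar> \<noteq> \<infinity>" and K: "\<And>y. f p \<le> f y + ereal (K * (dist p y)\<^sup>2)"
  shows "critical_point f p"
proof -
  obtain r where r: "f p = ereal r" using fin by auto
  have "slope f p = 0"
  proof (cases "p islimpt UNIV")
    case True
    then have nt: "at p \<noteq> bot" by (simp add: trivial_limit_within)
    let ?q = "\<lambda>y. max (f p - f y) 0 / ereal (dist p y)"
    have q: "?q y \<le> ereal (\<bar>K\<bar> * dist p y)" "0 \<le> ?q y" if "y \<noteq> p" for y
    proof -
      have d: "0 < dist p y" using that by simp
      \<comment> \<open>The bound must also dominate the 0 inside the maximum, and \<open>K\<close>
        may be negative.\<close>
      have K': "K * (dist p y)\<^sup>2 \<le> \<bar>K\<bar> * (dist p y)\<^sup>2" by (intro mult_right_mono) auto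
      have "f p - f y \<le> ereal (\<bar>K\<bar> * (dist p y)\<^sup>2)"
        using K[of y] r K' by (cases "f y") auto
      then have "max (f p - f y) 0 \<le> ereal (\<bar>K\<bar> * (dist p y)\<^sup>2)"
        by simp
      then have "?q y \<le> ereal (\<bar>K\<bar> * (dist p y)\<^sup>2) / ereal (dist p y)"
        using d by (intro ereal_divide_right_mono) auto
      then show "?q y \<le> ereal (\<bar>K\<bar> * dist p y)"
        using d by (simp add: power2_eq_square)
      show "0 \<le> ?q y" using d by (intro zero_le_divide_ereal) auto
    qed
    have "((\<lambda>y. ereal (\<bar>K\<bar> * dist p y)) \<longlongrightarrow> ereal (\<bar>K\<bar> * dist p p)) (at p)"
      by (intro tendsto_intros)
    then have lim: "((\<lambda>y. ereal (\<bar>K\<bar> * dist p y)) \<longlongrightarrow> 0) (at p)"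
      by (simp add: zero_ereal_def)
    have "(?q \<longlongrightarrow> 0) (at p)"
      by (rule tendsto_sandwich[OF _ _ tendsto_const lim])
        (auto intro!: eventually_at_topological[THEN iffD2] exI[of _ UNIV] q)
    from lim_imp_Limsup[OF nt this] True show ?thesis
      by (simp add: slope_def)
  qed (simp add: slope_def)
  then show ?thesis
    using r by (simp add: critical_point_def eff_domain_def)
qed

text \<open>If \<open>f a < f p\<close>, moving from \<open>p\<close> towards \<open>a\<close> by
  the fraction \<open>t\<close> lowers \<open>f\<close> by at least \<open>t * \<beta>\<close>, but
  the minorant allows only a decrease of order \<open>t\<^sup>2\<close>. Dividing by
  \<open>t\<close> and letting it tend to 0 contradicts \<open>\<beta> > 0\<close>.\<close>

lemma pseudo_convex_quadratic_minorant_min: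
  fixes f :: "'a::hadamard_space \<Rightarrow> ereal"
  assumes pc: "pseudo_convex f" and fin: "\<bar>f p\<bar> \<noteq> \<infinity>"
    and K: "\<And>y. f p \<le> f y + ereal (K * (dist p y)\<^sup>2)"
  shows "f p \<le> f a"
proof (rule ccontr)
  assume "\<not> f p \<le> f a"
  then obtain \<beta> \<delta> :: real where b: "\<beta> > 0" "0 < \<delta>" "\<delta> \<le> 1"
    and dec: "\<And>t. t \<in> {0<..<\<delta>} \<Longrightarrow> f p - f (geodesic_comb a p (1 - t)) \<ge> ereal (t * \<beta>)"
    using pc unfolding pseudo_convex_def by (meson not_le)
  obtain r where r: "f p = ereal r" using fin by auto
  have main: "\<beta> \<le> t * (K * (dist a p)\<^sup>2)" if t: "0 < t" "t < \<delta>" for t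
  proof -
    define w where "w = geodesic_comb a p (1 - t)"
    have "dist p w = t * dist a p"
      unfolding w_def using geodesic_comb(3)[of "1 - t" p a] t b by simp
    then have "f p \<le> f w + ereal (t * (t * (K * (dist a p)\<^sup>2)))"
      using K[of w] by (simp add: power_mult_distrib power2_eq_square mult_ac)
    moreover have "f p - f w \<ge> ereal (t * \<beta>)" unfolding w_def using dec t by auto
    ultimately have "t * \<beta> \<le> t * (t * (K * (dist a p)\<^sup>2))"
      using r by (cases "f w") auto
    then show ?thesis using t by simp
  qed
  have "\<beta> \<le> 0 * (K * (dist a p)\<^sup>2)"
  proof (rule tendsto_lowerbound)
    show "((\<lambda>t. t * (K * (dist a p)\<^sup>2)) \<longlongrightarrow> 0 * (K * (dist a p)\<^sup>2)) (at_right 0)"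
      by (intro tendsto_intros)
    show "\<forall>\<^sub>F t in at_right 0. \<beta> \<le> t * (K * (dist a p)\<^sup>2)"
      using main b(2) by (auto simp: eventually_at_right_field)
  qed simp
  with b(1) show False by simp
qed

section \<open>Convergence of the proximal iteration\<close>

theorem theorem3p7:
  fixes f :: "'a::hadamard_space \<Rightarrow> ereal"
    and \<alpha> lambda_bar :: real
    and lambda :: "nat \<Rightarrow> real"
    and x :: "nat \<Rightarrow> 'a"
    and C :: "'a set"
  assumes "\<alpha> > 0"
    and "proper f"
    and "lower_semicontinuous f"
    and "weakly_convex \<alpha> f"
    and "quasi_convex f"
    and "Argmin f \<noteq> {}"
    and "lambda_bar > 0"
    and "\<And>n. lambda_bar \<le> lambda n \<and> lambda n < 1 / (2 * \<alpha>)"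
    and "\<And>n. x (Suc n) = resolvent f (lambda n) (x n)"
    and "C = {z. \<forall>n. f z \<le> f (x n)}"
    and "\<exists>n>0. compact {z. f z \<le> f (x n)}"
  shows "(\<exists>p\<in>C. x \<longlonglongrightarrow> p \<and> critical_point f p) \<and>
         (pseudo_convex f \<longrightarrow> (\<exists>p\<in>Argmin f. x \<longlonglongrightarrow> p))"
proof -
  note pr = assms(2) and lsc = assms(3)
  define K where "K = 1 / (2 * lambda_bar)"
  have f: "f y \<noteq> -\<infinity>" for y using pr by (simp add: proper_def)
  obtain b where "f b < \<infinity>" using pr by (auto simp: proper_def eff_domain_def)
  then obtain fb where fb: "f b = ereal fb" using f[of b] by (cases "f b") auto
  have pos: "0 < lambda n" for n using assms(7) assms(8)[of n] by linarith
  have step: "f (x (Suc n)) + ereal (1 / (2 * lambda n) * (dist (x n) (x (Suc n)))\<^sup>2)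
      \<le> f y + ereal (1 / (2 * lambda n) * (dist (x n) y)\<^sup>2)" for n y
    unfolding assms(9)
    using resolvent_le[OF assms(2-4,6) pos] assms(1,8) by blast
  \<comment> \<open>Finiteness starts at index 1, since \<open>f (x 0)\<close> may be infinite.
    Testing minimality at \<open>b\<close> gives the upper bound.\<close>
  have fin: "\<bar>f (x (Suc n))\<bar> \<noteq> \<infinity>" for n
    using step[of n b] fb f by (cases "f (x (Suc n))") auto
  \<comment> \<open>Since \<open>lambda_bar \<le> lambda n\<close>, the constant \<open>K\<close>
    dominates all coefficients \<open>1 / (2 * lambda n)\<close>.\<close>
  have le: "f (x (Suc n)) \<le> f y + ereal (K * (dist (x n) y)\<^sup>2)" for n y
  proof -
    have "1 / (2 * lambda n) * (dist (x n) y)\<^sup>2 \<le> K * (dist (x n) y)\<^sup>2"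
      unfolding K_def using assms(7,8) pos[of n]
      by (intro mult_right_mono divide_left_mono) auto
    then have "f y + ereal (1 / (2 * lambda n) * (dist (x n) y)\<^sup>2) \<le> f y + ereal (K * (dist (x n) y)\<^sup>2)"
      by (intro add_left_mono) simp
    moreover have "f (x (Suc n)) + 0
        \<le> f (x (Suc n)) + ereal (1 / (2 * lambda n) * (dist (x n) (x (Suc n)))\<^sup>2)"
      using pos[of n] by (intro add_left_mono) simp
    ultimately show ?thesis using step[of n y] by (metis add.right_neutral order_trans)
  qed
  have "f (x (Suc n)) \<le> f (x n)" for n
    using le[of n "x n"] by (simp flip: zero_ereal_def)
  then have dec: "f (x n) \<le> f (x m)" if "m \<le> n" for m n
    using that by (rule lift_Suc_antimono_le)
  obtain N where "compact {z. f z \<le> f (x N)}" using assms(11) by blast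
  \<comment> \<open>The values of \<open>f\<close> decrease along the iterates, so the sequence
    shifted by \<open>N\<close> stays in the compact sublevel set.\<close>
  then obtain p r where r: "strict_mono (r :: nat \<Rightarrow> nat)" and "((\<lambda>n. x (n + N)) \<circ> r) \<longlonglongrightarrow> p"
    unfolding compact_def using dec by (force dest!: spec[of _ "\<lambda>n. x (n + N)"])
  then have sub: "(\<lambda>k. x (r k + N)) \<longlonglongrightarrow> p" by (simp add: o_def)
  have pC: "f p \<le> f (x n)" for n
  proof (rule lower_semicontinuous_le_lim[OF lsc sub _ tendsto_const])
    show "\<forall>\<^sub>F k in sequentially. f (x (r k + N)) \<le> f (x n)"
      unfolding eventually_sequentially
      \<comment> \<open>For \<open>k\<close> at least \<open>n\<close>, the index
        \<open>r k + N\<close> is at least \<open>n\<close>, so \<open>dec\<close> applies.\<close>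
      using seq_suble[OF r] by (intro exI[of _ n] allI impI dec) (meson order_trans trans_le_add1)
  qed
  have fejer: "dist (x (Suc n)) p \<le> dist (x n) p" for n
    by (rule quasi_convex_prox_fejer[OF assms(5) _ fin step pC]) (use pos[of n] in simp)
  have mono: "dist (x n) p \<le> dist (x m) p" if "m \<le> n" for m n
    using that by (rule lift_Suc_antimono_le[of "\<lambda>n. dist (x n) p", OF fejer])
  have conv: "x \<longlonglongrightarrow> p"
  proof (rule metric_LIMSEQ_I)
    fix e :: real assume "0 < e"
    then obtain k where "dist (x (r k + N)) p < e"
      using metric_LIMSEQ_D[OF sub] by blast
    then show "\<exists>n0. \<forall>n\<ge>n0. dist (x n) p < e" using mono by (meson order_le_less_trans)
  qed
  have pfin: "\<bar>f p\<bar> \<noteq> \<infinity>"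
    using pC[of "Suc 0"] fin[of 0] f[of p] by (cases "f p") auto
  have minorant: "f p \<le> f y + ereal (K * (dist p y)\<^sup>2)" for y
  proof (rule LIMSEQ_le_const)
    show "(\<lambda>n. f y + ereal (K * (dist (x n) y)\<^sup>2)) \<longlonglongrightarrow> f y + ereal (K * (dist p y)\<^sup>2)"
      \<comment> \<open>If \<open>f y\<close> is infinite, the sequence is constantly infinite;
        otherwise the limit is one of real numbers.\<close>
      using f[of y] by (cases "f y") (auto intro!: tendsto_intros conv)
    show "\<exists>N. \<forall>n\<ge>N. f p \<le> f y + ereal (K * (dist (x n) y)\<^sup>2)"
      using order_trans[OF pC le] by blast
  qed
  have "p \<in> C" using pC assms(10) by simp
  moreover have "critical_point f p"
    by (rule critical_point_if_quadratic_minorant[OF pfin minorant])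
  moreover have "p \<in> Argmin f" if "pseudo_convex f"
    using pseudo_convex_quadratic_minorant_min[OF that pfin minorant] by (simp add: Argmin_iff)
  ultimately show ?thesis using conv by blast
qed

end
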